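(* Let $\sum_{k=0}^{\infty}a_k$ be a convergent series of complex numbers and let $\{b_n\}_{n=0}^{\infty}$ be any sequence of complex numbers whose limit is zero and such that $a_n+b_n-b_{n-1}\neq 0$ for all $n\geq 1$. Then $$\sum_{i=0}^{\infty}a_i=a_0+b_0+\mathop{K}_{n=1}^{\infty}\frac{p_n}{q_n},$$ where $$p_1=a_1+b_1-b_0,\qquad q_1=1,$$ $$p_2=-a_2+b_1-b_2,\qquad q_2=a_2+a_1+b_2-b_0,$$ and, for $n\geq 3$, $$p_n=-(a_{n-2}+b_{n-2}-b_{n-3})(a_n+b_n-b_{n-1}),\qquad q_n=a_n+a_{n-1}+b_n-b_{n-2}.$$ (In particular, the continued fraction converges.)
   Context: For sequences $\{p_n\}_{n\ge1}$, $\{q_n\}_{n\ge1}$ of complex numbers, the continued fraction $\mathop{K}_{n=1}^{\infty} p_n/q_n$ is $$\cfrac{p_1}{q_1+\cfrac{p_2}{q_2+\cfrac{p_3}{q_3+\cdots}}}.$$ Its $N$-th approximant is $A_N/B_N$, where $A_N=q_NA_{N-1}+p_NA_{N-2}$ and $B_N=q_NB_{N-1}+p_NB_{N-2}$ for $N\ge 1$, with $A_{-1}=1$, $A_0=0$, $B_{-1}=0$, $B_0=1$. The symbol $\mathop{K}_{n=1}^{\infty} p_n/q_n$ also denotes the limit $\lim_{N\to\infty}A_N/B_N$ when it exists, in which case the continued fraction is said to converge. *)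

theory Defs
  imports Complex_Main
begin

text \<open>
  Continued fractions with partial numerators \<open>p 1, p 2, \<dots>\<close> and partial denominators
  \<open>q 1, q 2, \<dots>\<close>; the entries at index 0 are irrelevant.
  \<open>cf_rec p q u v\<close> is the solution \<open>X\<close> of the recurrence \<open>X N = q N * X (N - 1) + p N * X (N - 2)\<close>
  for \<open>N \<ge> 1\<close>, where the initial values at index \<open>-1\<close> and \<open>0\<close> are \<open>u\<close> and \<open>v\<close>.
\<close>

fun cf_rec :: "(nat \<Rightarrow> complex) \<Rightarrow> (nat \<Rightarrow> complex) \<Rightarrow> complex \<Rightarrow> complex \<Rightarrow> nat \<Rightarrow> complex" where
  "cf_rec p q u v 0 = v"
| "cf_rec p q u v (Suc 0) = q 1 * v + p 1 * u"
| "cf_rec p q u v (Suc (Suc n)) =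
     q (n + 2) * cf_rec p q u v (Suc n) + p (n + 2) * cf_rec p q u v n"

definition cf_num :: "(nat \<Rightarrow> complex) \<Rightarrow> (nat \<Rightarrow> complex) \<Rightarrow> nat \<Rightarrow> complex" where
  "cf_num p q = cf_rec p q 1 0"

definition cf_den :: "(nat \<Rightarrow> complex) \<Rightarrow> (nat \<Rightarrow> complex) \<Rightarrow> nat \<Rightarrow> complex" where
  "cf_den p q = cf_rec p q 0 1"

definition cf_approximant :: "(nat \<Rightarrow> complex) \<Rightarrow> (nat \<Rightarrow> complex) \<Rightarrow> nat \<Rightarrow> complex" where
  "cf_approximant p q N = cf_num p q N / cf_den p q N"

text \<open>
  Since \<open>x / 0 = 0\<close>, convergence of the approximants alone would not exclude approximants
  that are undefined; the first conjunct allows only finitely many of these.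
\<close>

definition cf_convergent :: "(nat \<Rightarrow> complex) \<Rightarrow> (nat \<Rightarrow> complex) \<Rightarrow> bool" where
  "cf_convergent p q \<longleftrightarrow>
     (\<forall>\<^sub>F N in sequentially. cf_den p q N \<noteq> 0) \<and> convergent (cf_approximant p q)"

definition cf_value :: "(nat \<Rightarrow> complex) \<Rightarrow> (nat \<Rightarrow> complex) \<Rightarrow> complex" where
  "cf_value p q = lim (cf_approximant p q)"

end

theory Submission
  imports Defs
begin

text \<open>
  Put \<open>c n = a n + b n - b (n - 1)\<close>. Then \<open>p\<close> and \<open>q\<close> are entries that Euler's
  correspondence between series and continued fractions attaches to \<open>\<Sum> c n\<close>, so that the
  \<open>N\<close>-th approximant equals the partial sum \<open>c 1 + \<dots> + c N\<close>. The \<open>b\<close>-terms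
  telescope: this partial sum is \<open>a 1 + \<dots> + a N + b N - b 0\<close>, and \<open>b N\<close> tends to \<open>0\<close>.

  Euler's correspondence is the closed form \<open>cf_rec_euler\<close>. It describes the whole
  two-dimensional solution space of the recurrence at once: the denominators are products
  \<open>c 1 \<cdots> c (N - 1)\<close>, the numerators are the same products times the partial sums.
  The denominators are nonzero because the \<open>c n\<close> are, so every approximant is defined.
\<close>

text \<open>
  The recurrence preserves the product shape because of the identity
  \<open>(z + y) * x * (s + u * y) - x * z * s = x * y * (s + u * y + u * z)\<close>, where \<open>x\<close>, \<open>y\<close>, \<open>z\<close>
  are consecutive terms of \<open>c\<close> and \<open>s\<close> is \<open>v\<close> plus \<open>u\<close> times the partial sum ending
  in \<open>x\<close>. The entries \<open>p 1\<close>, \<open>q 1\<close>, \<open>p 2\<close> break the pattern because it would involve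
  terms of \<open>c\<close> with index below 1, while the product starts with \<open>c 1\<close>. Initial values \<open>(u, v) = (0, 1)\<close> give the
  denominators and \<open>(1, 0)\<close> the numerators.
\<close>

lemma cf_rec_euler:
  fixes c p q :: "nat \<Rightarrow> complex"
  assumes p1: "p 1 = c 1" and q1: "q 1 = 1"
    and p2: "p 2 = - c 2" and q: "\<And>n. n \<ge> 2 \<Longrightarrow> q n = c n + c (n - 1)"
    and p: "\<And>n. n \<ge> 3 \<Longrightarrow> p n = - c (n - 2) * c n"
  shows "cf_rec p q u v n = (\<Prod>k=1..<n. c k) * (v + u * (\<Sum>k=1..n. c k))"
proof (induction n rule: induct_nat_012)
  case 0
  show ?case by simp
next
  case 1
  show ?case using p1 q1 by simp
next
  case (ge2 n)
  show ?case
  proof (cases n)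
    case 0
    then show ?thesis
      using p1 q1 p2 q[of 2] by (simp add: numeral_2_eq_2 algebra_simps)
  next
    case (Suc m)
    define P where "P = (\<Prod>k=1..<Suc m. c k)"
    define T where "T = (\<Sum>k=1..Suc m. c k)"
    have p3: "p (m + 3) = - c (m + 1) * c (m + 3)"
      and q3: "q (m + 3) = c (m + 3) + c (m + 2)"
      using p[of "m + 3"] q[of "m + 3"] by (simp_all add: numeral_eq_Suc)
    have "cf_rec p q u v (Suc (Suc n)) =
        (c (m + 3) + c (m + 2)) * (P * c (m + 1) * (v + u * (T + c (m + 2))))
        + - c (m + 1) * c (m + 3) * (P * (v + u * T))"
      using ge2 p3 q3 Suc by (simp add: P_def T_def numeral_eq_Suc)
    also have "\<dots> = P * c (m + 1) * c (m + 2) * (v + u * (T + c (m + 2) + c (m + 3)))"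
      by (simp add: algebra_simps)
    also have "\<dots> = (\<Prod>k=1..<Suc (Suc n). c k) * (v + u * (\<Sum>k=1..Suc (Suc n). c k))"
      using Suc by (simp add: P_def T_def numeral_eq_Suc)
    finally show ?thesis .
  qed
qed

theorem proposition3:
  fixes a b p q :: "nat \<Rightarrow> complex"
  assumes "summable a"
    and "b \<longlonglongrightarrow> 0"
    and "\<And>n. n \<ge> 1 \<Longrightarrow> a n + b n - b (n - 1) \<noteq> 0"
    and "p 1 = a 1 + b 1 - b 0"
    and "q 1 = 1"
    and "p 2 = - a 2 + b 1 - b 2"
    and "q 2 = a 2 + a 1 + b 2 - b 0"
    and "\<And>n. n \<ge> 3 \<Longrightarrow>
           p n = - (a (n - 2) + b (n - 2) - b (n - 3)) * (a n + b n - b (n - 1))"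
    and "\<And>n. n \<ge> 3 \<Longrightarrow> q n = a n + a (n - 1) + b n - b (n - 2)"
  shows "cf_convergent p q \<and> (\<Sum>i. a i) = a 0 + b 0 + cf_value p q"
proof -
  define c where "c n = a n + b n - b (n - 1)" for n
  have q_eq: "q n = c n + c (n - 1)" if "n \<ge> 2" for n
  proof (cases "n = 2")
    case True
    then show ?thesis using assms(7) by (simp add: c_def)
  next
    case False
    then have "n \<ge> 3" using that by simp
    then show ?thesis using assms(9)[of n] by (simp add: c_def numeral_2_eq_2)
  qed
  have p_eq: "p n = - c (n - 2) * c n" if "n \<ge> 3" for n
    using assms(8)[OF that] by (simp add: c_def)
  have p1: "p 1 = c 1" and p2: "p 2 = - c 2"
    using assms(4,6) by (simp_all add: c_def)
  note closed_form = cf_rec_euler[of p c q, OF p1 assms(5) p2 q_eq p_eq]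
  have den: "cf_den p q N = (\<Prod>k=1..<N. c k)" for N
    unfolding cf_den_def by (subst closed_form) simp_all
  have num: "cf_num p q N = (\<Prod>k=1..<N. c k) * (\<Sum>k=1..N. c k)" for N
    unfolding cf_num_def by (subst closed_form) simp_all
  have den_nz: "cf_den p q N \<noteq> 0" for N
    unfolding den using assms(3) by (auto simp: c_def)
  have telescope: "(\<Sum>k=1..N. c k) = (\<Sum>k\<le>N. a k) - a 0 + b N - b 0" for N
    by (induction N) (simp_all add: c_def)
  have approximant: "cf_approximant p q = (\<lambda>N. (\<Sum>k\<le>N. a k) - a 0 + b N - b 0)"
  proof
    fix N
    have "cf_approximant p q N = (\<Sum>k=1..N. c k)"
      using den_nz[of N] unfolding cf_approximant_def num den by simp
    then show "cf_approximant p q N = (\<Sum>k\<le>N. a k) - a 0 + b N - b 0"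
      using telescope by simp
  qed
  have "cf_approximant p q \<longlonglongrightarrow> (\<Sum>i. a i) - a 0 + 0 - b 0"
    unfolding approximant
    by (intro tendsto_intros summable_LIMSEQ' assms(1,2))
  then have lim: "cf_approximant p q \<longlonglongrightarrow> (\<Sum>i. a i) - a 0 - b 0"
    by simp
  have "cf_convergent p q"
    unfolding cf_convergent_def using den_nz lim by (auto intro: convergentI)
  moreover have "cf_value p q = (\<Sum>i. a i) - a 0 - b 0"
    unfolding cf_value_def using lim by (rule limI)
  ultimately show ?thesis by simp
qed

end
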